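(* Let $q=p^s$ with $p>2$ a prime and $s$ a positive integer, and let $h\in\mathbb{F}_{q^6}$ be such that $h^{q^3+1}=-1$ and $h\notin\mathbb{F}_q$. Then the polynomial $f_h(x)=h^{q-1}x^q-h^{q^2-1}x^{q^2}+x^{q^4}+x^{q^5}$ is a scattered $q$-polynomial over $\mathbb{F}_{q^6}$.
   Context: For a $q$-polynomial $f(x)=\sum_{i=0}^{n-1}a_ix^{q^i}\in\mathbb{F}_{q^n}[x]$ let $U_f=\{(x,f(x)):x\in\mathbb{F}_{q^n}\}$, an $n$-dimensional $\mathbb{F}_q$-subspace of $\mathbb{F}_{q^n}^2$, and let $L_f=\{\langle \mathbf{u}\rangle_{\mathbb{F}_{q^n}}:\mathbf{u}\in U_f\setminus\{\mathbf 0\}\}\subseteq \mathrm{PG}(1,q^n)$ be the associated linear set. The polynomial $f$ is called scattered if $L_f$ is maximum scattered, i.e. $|L_f|=(q^n-1)/(q-1)$ (equivalently, $f(x)/x$ takes exactly $(q^n-1)/(q-1)$ values on $\mathbb{F}_{q^n}\setminus\{0\}$). Here $n=6$. *)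

theory Defs
  imports
    "HOL-Computational_Algebra.Primes"
    "HOL-Computational_Algebra.Polynomial"
    "HOL-Library.Cardinality"
begin

definition is_subfield :: "'a::field set \<Rightarrow> bool" where
  "is_subfield K \<longleftrightarrow> 0 \<in> K \<and> 1 \<in> K \<and>
     (\<forall>x\<in>K. \<forall>y\<in>K. x + y \<in> K \<and> x * y \<in> K) \<and>
     (\<forall>x\<in>K. - x \<in> K \<and> inverse x \<in> K)"

text \<open>Below, the type \<open>'a\<close> plays the role of the field with \<open>q ^ n\<close> elements; theorems have to
  assume \<open>CARD('a) = q ^ n\<close>.\<close>

definition q_polynomial :: "nat \<Rightarrow> nat \<Rightarrow> 'a::finite_field poly \<Rightarrow> bool" where
  "q_polynomial q n f \<longleftrightarrow> (\<exists>a :: nat \<Rightarrow> 'a. f = (\<Sum>i<n. monom (a i) (q ^ i)))"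

definition graph_space :: "'a::finite_field poly \<Rightarrow> ('a \<times> 'a) set" where
  "graph_space f = {(x, poly f x) | x. True}"

text \<open>For \<open>u \<noteq> (0, 0)\<close> the line spanned by \<open>u\<close> in the plane over \<open>'a\<close>, i.e. a point of the
  projective line.\<close>

definition line_span :: "'a::field \<times> 'a \<Rightarrow> ('a \<times> 'a) set" where
  "line_span u = {(c * fst u, c * snd u) | c. True}"

definition linear_set :: "'a::finite_field poly \<Rightarrow> ('a \<times> 'a) set set" where
  "linear_set f = line_span ` (graph_space f - {(0, 0)})"

text \<open>For \<open>q > 1\<close> the division of natural numbers below is exact.\<close>

definition scattered :: "nat \<Rightarrow> nat \<Rightarrow> 'a::finite_field poly \<Rightarrow> bool" where
  "scattered q n f \<longleftrightarrow> card (linear_set f) = (q ^ n - 1) div (q - 1)"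

definition f_poly :: "nat \<Rightarrow> 'a::finite_field \<Rightarrow> 'a poly" where
  "f_poly q h = monom (h ^ (q - 1)) q - monom (h ^ (q\<^sup>2 - 1)) (q\<^sup>2)
     + monom 1 (q ^ 4) + monom 1 (q ^ 5)"

end

theory Submission
  imports Defs
begin

text \<open>
  Write \<open>\<sigma>\<close> for the Frobenius map \<open>x \<mapsto> x ^ q\<close>, an automorphism with \<open>\<sigma>\<^sup>6 = id\<close>, and
  \<open>h\<^sub>i = \<sigma>\<^sup>i h\<close>, so that \<open>h\<^sub>i * h\<^sub>i\<^sub>+\<^sub>3 = -1\<close>. Two nonzero points of the graph of \<open>f\<close> span the same line iff
  \<open>f x * y = f y * x\<close>, so \<open>f\<close> is scattered iff this equation forces \<open>y = k * x\<close> with \<open>\<sigma> k = k\<close>: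
  the nonzero elements then fall into classes of size \<open>q - 1\<close>.

  The involution \<open>\<sigma>\<^sup>3\<close> decouples the terms of \<open>f\<close>. Over its fixed field, \<open>h * x = X + Y\<close> for
  unique \<open>X\<close>, \<open>Y\<close> in the two lines \<open>\<sigma>\<^sup>3 X = h\<^sub>2 h\<^sub>3 X\<close> and \<open>\<sigma>\<^sup>3 Y = - h\<^sub>1 h\<^sub>3 Y\<close>
  (\<open>eigen_decomposition\<close>), and in these coordinates
  \<open>f x = \<sigma> B * \<sigma>\<^sup>2 X - B * \<sigma> Y\<close> with \<open>B = h\<^sub>2 + h\<^sub>3\<close> (\<open>twisted_map_decomposed\<close>). Let
  \<open>h * y = Z + W\<close> likewise. Comparing \<open>f x * y = f y * x\<close> with its image under \<open>\<sigma>\<^sup>3\<close> splits it into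

  \<^item> \<open>\<sigma> B * (\<sigma>\<^sup>2 X * Z - \<sigma>\<^sup>2 Z * X) = B * (\<sigma> Y * W - \<sigma> W * Y)\<close>, and
  \<^item> \<open>\<sigma> B * \<sigma>\<^sup>2 M = h\<^sub>2 h\<^sub>3 * B * M\<close> for \<open>M = \<sigma> Y * Z - \<sigma> W * X\<close>.

  Both are settled by multiplying an equation with its images under \<open>\<sigma>\<close> and \<open>\<sigma>\<^sup>2\<close>. If \<open>M \<noteq> 0\<close> in the
  second, the products of the two sides are nonzero and opposite, so \<open>M = 0\<close> as \<open>2 \<noteq> 0\<close>.
  Hence \<open>(X, Z)\<close> is proportional to \<open>(\<sigma> Y, \<sigma> W)\<close>, say with factor \<open>m\<close>, when \<open>Y \<noteq> 0\<close>. The first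
  equation then says that \<open>\<sigma> Y * W = \<sigma> W * Y\<close>, which means that \<open>W / Y\<close> is fixed by \<open>\<sigma>\<close>, or that
  \<open>B = \<sigma> B * h\<^sub>1 h\<^sub>3 * m * \<sigma>\<^sup>2 m\<close>. In the latter case the product over the images gives
  \<open>(h\<^sub>3 * g)\<^sup>2 = 1\<close> for \<open>g = m * \<sigma> m * \<sigma>\<^sup>2 m\<close>, so \<open>h\<^sub>3 * g = \<plusminus> 1\<close> is fixed by \<open>\<sigma>\<close>, whereas the way
  \<open>\<sigma>\<^sup>3\<close> acts on \<open>m\<close> gives \<open>\<sigma> (h\<^sub>3 * g) = - h\<^sub>3 * g\<close>. When \<open>Y = 0\<close>, also \<open>W = 0\<close>, and the first
  equation makes \<open>Z / X\<close> a fixed point of both \<open>\<sigma>\<^sup>2\<close> and \<open>\<sigma>\<^sup>3\<close>.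
\<close>

section \<open>Fields with an automorphism of order dividing six\<close>

text \<open>Abstracting the Frobenius map to an automorphism \<open>\<sigma>\<close> hides the exponents \<open>q\<^sup>i\<close>: taking a conjugate
  becomes a rewriting step, and what remains are polynomial identities modulo \<open>h\<^sub>i * h\<^sub>i\<^sub>+\<^sub>3 = -1\<close>.\<close>

locale order_six_twist =
  fixes \<sigma> :: "'a::field \<Rightarrow> 'a" and h :: 'a
  assumes sigma_add: "\<sigma> (x + y) = \<sigma> x + \<sigma> y"
    and sigma_mult: "\<sigma> (x * y) = \<sigma> x * \<sigma> y"
    and sigma_period: "\<sigma> (\<sigma> (\<sigma> (\<sigma> (\<sigma> (\<sigma> x))))) = x"
    and two_neq_0: "(2::'a) \<noteq> 0"
    and h_norm: "h * \<sigma> (\<sigma> (\<sigma> h)) = - 1"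
begin

lemma sigma_inj: "\<sigma> x = \<sigma> y \<longleftrightarrow> x = y"
  using sigma_period by metis

lemma sigma_0: "\<sigma> 0 = 0"
  using sigma_add[of 0 0] by (metis add.right_neutral add_left_cancel)

lemma sigma_eq_0_iff: "\<sigma> x = 0 \<longleftrightarrow> x = 0"
  using sigma_inj[of x 0] by (simp add: sigma_0)

lemma sigma_1: "\<sigma> 1 = 1"
  using sigma_mult[of 1 1] sigma_eq_0_iff[of 1] by simp

lemma sigma_minus: "\<sigma> (- x) = - \<sigma> x"
  using sigma_add[of x "- x"] by (simp add: sigma_0 eq_neg_iff_add_eq_0 add.commute)

lemma sigma_diff: "\<sigma> (x - y) = \<sigma> x - \<sigma> y"
  using sigma_add[of x "- y"] by (simp add: sigma_minus)

lemma sigma_divide: "\<sigma> (x / y) = \<sigma> x / \<sigma> y"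
proof (cases "y = 0")
  case False
  have "\<sigma> (x / y) * \<sigma> y = \<sigma> x"
    using False by (simp flip: sigma_mult)
  then show ?thesis
    using False by (simp add: sigma_eq_0_iff eq_divide_eq)
qed (simp add: sigma_0)

lemmas sigma_simps = sigma_0 sigma_1 sigma_add sigma_mult sigma_minus sigma_diff sigma_divide
  sigma_period sigma_eq_0_iff

lemma h_norm_1: "\<sigma> h * \<sigma> (\<sigma> (\<sigma> (\<sigma> h))) = - 1"
  using arg_cong[OF h_norm, of \<sigma>] by (simp add: sigma_simps)

lemma h_norm_2: "\<sigma> (\<sigma> h) * \<sigma> (\<sigma> (\<sigma> (\<sigma> (\<sigma> h)))) = - 1"
  using arg_cong[OF h_norm_1, of \<sigma>] by (simp add: sigma_simps)

lemma h_neq_0: "h \<noteq> 0"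
  using h_norm by auto

text \<open>If \<open>\<sigma> h = - h\<close>, then \<open>\<sigma>\<^sup>3 h = - h\<close>, so the norm condition reads \<open>h\<^sup>2 = 1\<close>; but \<open>\<plusminus> 1\<close> is fixed
  by \<open>\<sigma>\<close>. This is what makes the two eigenlines below distinct.\<close>

lemma conjugate_sum_neq_0: "h + \<sigma> h \<noteq> 0"
proof
  assume "h + \<sigma> h = 0"
  then have h1: "\<sigma> h = - h"
    by (metis add.commute eq_neg_iff_add_eq_0)
  then have "\<sigma> (\<sigma> (\<sigma> h)) = - h"
    by (simp add: sigma_minus)
  with h_norm have "h * h = 1"
    by simp
  then have "h = 1 \<or> h = - 1"
    by (simp add: square_eq_1_iff)
  then have "\<sigma> h = h"
    by (auto simp: sigma_1 sigma_minus)
  with h1 have "2 * h = 0"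
    by (metis add.right_inverse mult_2)
  with two_neq_0 h_neq_0 show False
    by simp
qed

section \<open>The decomposition under the involution\<close>

text \<open>The two lines are the eigenspaces for the factors \<open>h\<^sub>2 h\<^sub>3\<close> and \<open>- h\<^sub>1 h\<^sub>3\<close>. They are distinct
  because \<open>h\<^sub>1 + h\<^sub>2 \<noteq> 0\<close>, and \<open>X\<close>, \<open>Y\<close> are the solutions of the linear system formed by
  \<open>u = X + Y\<close> and its image under \<open>\<sigma>\<^sup>3\<close>.\<close>

lemma eigen_decomposition:
  obtains X Y where "u = X + Y"
    and "\<sigma> (\<sigma> (\<sigma> X)) = \<sigma> (\<sigma> h) * \<sigma> (\<sigma> (\<sigma> h)) * X"
    and "\<sigma> (\<sigma> (\<sigma> Y)) = - (\<sigma> h * \<sigma> (\<sigma> (\<sigma> h)) * Y)"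
proof -
  define h1 h2 h3 h4 h5 where hs: "h1 = \<sigma> h" "h2 = \<sigma> h1" "h3 = \<sigma> h2" "h4 = \<sigma> h3" "h5 = \<sigma> h4"
  define u3 where "u3 = \<sigma> (\<sigma> (\<sigma> u))"
  have r: "h * h3 = - 1" "h1 * h4 = - 1" "h2 * h5 = - 1"
    using h_norm h_norm_1 h_norm_2 by (simp_all add: hs)
  have "\<sigma> (h + \<sigma> h) \<noteq> 0" "\<sigma> (\<sigma> (\<sigma> (\<sigma> (h + \<sigma> h)))) \<noteq> 0"
    using conjugate_sum_neq_0 by (simp_all only: sigma_eq_0_iff not_False_eq_True)
  then have S: "h1 + h2 \<noteq> 0" and S3: "h4 + h5 \<noteq> 0"
    by (simp_all add: hs sigma_add)
  define X where "X = (h1 * u - h * u3) / (h1 + h2)"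
  define Y where "Y = (h2 * u + h * u3) / (h1 + h2)"
  have X3: "\<sigma> (\<sigma> (\<sigma> X)) = (h4 * u3 - h3 * u) / (h4 + h5)"
    and Y3: "\<sigma> (\<sigma> (\<sigma> Y)) = (h5 * u3 + h3 * u) / (h4 + h5)"
    unfolding X_def Y_def by (simp_all add: u3_def hs sigma_simps)
  have "(h4 * u3 - h3 * u) * (h1 + h2) = h2 * h3 * (h1 * u - h * u3) * (h4 + h5)"
    using r by algebra
  then have 1: "\<sigma> (\<sigma> (\<sigma> X)) = h2 * h3 * X"
    unfolding X3 unfolding X_def using S S3 by (simp add: field_simps)
  have "(h5 * u3 + h3 * u) * (h1 + h2) = - (h1 * h3 * (h2 * u + h * u3)) * (h4 + h5)"
    using r by algebra
  then have 2: "\<sigma> (\<sigma> (\<sigma> Y)) = - (h1 * h3 * Y)"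
    unfolding Y3 unfolding Y_def using S S3 by (simp add: divide_simps)
  have "u = X + Y"
    unfolding X_def Y_def add_divide_distrib[symmetric] using S
    by (simp add: eq_divide_eq algebra_simps)
  with 1 2 show ?thesis
    by (intro that[of X Y]) (simp_all add: hs)
qed

text \<open>For the Frobenius map \<open>\<sigma>\<close> the factor \<open>\<sigma> h / h\<close> is \<open>h ^ (q - 1)\<close>, so this is the polynomial
  function under study; division avoids exponents that involve \<open>q\<close>.\<close>

definition twisted_map :: "'a \<Rightarrow> 'a" where
  "twisted_map x = \<sigma> h / h * \<sigma> x - \<sigma> (\<sigma> h) / h * \<sigma> (\<sigma> x)
     + \<sigma> (\<sigma> (\<sigma> (\<sigma> x))) + \<sigma> (\<sigma> (\<sigma> (\<sigma> (\<sigma> x))))"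

text \<open>Multiplied by \<open>h\<close>, the map is a combination of \<open>\<sigma>\<close> and \<open>\<sigma>\<^sup>2\<close> applied to \<open>h * x\<close> and to
  \<open>\<sigma>\<^sup>3 (h * x)\<close>. The eigenlines are chosen such that the \<open>\<sigma> X\<close> and \<open>\<sigma>\<^sup>2 Y\<close> contributions cancel.\<close>

lemma twisted_map_decomposed:
  assumes "h * x = X + Y"
    and X3: "\<sigma> (\<sigma> (\<sigma> X)) = \<sigma> (\<sigma> h) * \<sigma> (\<sigma> (\<sigma> h)) * X"
    and Y3: "\<sigma> (\<sigma> (\<sigma> Y)) = - (\<sigma> h * \<sigma> (\<sigma> (\<sigma> h)) * Y)"
  shows "twisted_map x = (\<sigma> (\<sigma> (\<sigma> h)) + \<sigma> (\<sigma> (\<sigma> (\<sigma> h)))) * \<sigma> (\<sigma> X)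
     - (\<sigma> (\<sigma> h) + \<sigma> (\<sigma> (\<sigma> h))) * \<sigma> Y"
proof -
  define h1 h2 h3 h4 h5 where hs: "h1 = \<sigma> h" "h2 = \<sigma> h1" "h3 = \<sigma> h2" "h4 = \<sigma> h3" "h5 = \<sigma> h4"
  define x1 x2 x3 x4 x5 where xs: "x1 = \<sigma> x" "x2 = \<sigma> x1" "x3 = \<sigma> x2" "x4 = \<sigma> x3" "x5 = \<sigma> x4"
  define X1 X2 Y1 Y2 where XYs: "X1 = \<sigma> X" "X2 = \<sigma> X1" "Y1 = \<sigma> Y" "Y2 = \<sigma> Y1"
  have r: "h * h3 = - 1" "h1 * h4 = - 1" "h2 * h5 = - 1"
    using h_norm h_norm_1 h_norm_2 by (simp_all add: hs)
  have c1: "h1 * x1 = X1 + Y1"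
    using arg_cong[OF assms(1), of \<sigma>] by (simp add: hs xs XYs sigma_simps)
  have c2: "h2 * x2 = X2 + Y2"
    using arg_cong[OF c1, of \<sigma>] by (simp add: hs xs XYs sigma_simps)
  have c3: "h3 * x3 = h2 * h3 * X - h1 * h3 * Y"
    using arg_cong[OF c2, of \<sigma>] X3 Y3 by (simp add: hs xs XYs sigma_simps)
  have c4: "h4 * x4 = h3 * h4 * X1 - h2 * h4 * Y1"
    using arg_cong[OF c3, of \<sigma>] by (simp add: hs xs XYs sigma_simps)
  have c5: "h5 * x5 = h4 * h5 * X2 - h3 * h5 * Y2"
    using arg_cong[OF c4, of \<sigma>] by (simp add: hs xs XYs sigma_simps)
  have x4: "x4 = h3 * X1 - h2 * Y1"
    using c4 r by algebra
  have x5: "x5 = h4 * X2 - h3 * Y2"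
    using c5 r by algebra
  have "h1 * x1 - h2 * x2 + h * x4 + h * x5 = h * ((h3 + h4) * X2 - (h2 + h3) * Y1)"
    unfolding c1 c2 x4 x5 using r(1) by algebra
  then have "h1 / h * x1 - h2 / h * x2 + x4 + x5 = (h3 + h4) * X2 - (h2 + h3) * Y1"
    using h_neq_0 by (simp add: field_simps)
  then show ?thesis
    by (simp add: twisted_map_def hs xs XYs)
qed

section \<open>Proportionality of points on a common line\<close>

lemma fixed_ratio:
  assumes "a \<noteq> 0" and "\<sigma> a * b = \<sigma> b * a"
  shows "\<sigma> (b / a) = b / a"
  using assms by (simp add: sigma_simps field_simps)

text \<open>Every quantity built from \<open>X\<close>, \<open>Y\<close>, \<open>Z\<close>, \<open>W\<close> below is homogeneous for the eigenline decomposition, so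
  \<open>\<sigma>\<^sup>3\<close> multiplies it by a known monomial in the conjugates of \<open>h\<close>; this is what turns products over
  conjugates into contradictions. A digit appended to \<open>h\<close>, \<open>B\<close>, \<open>X\<close>, \<open>Y\<close>, \<open>Z\<close>, \<open>W\<close>, \<open>M\<close> or \<open>m\<close>
  counts applications of \<open>\<sigma>\<close>.\<close>

lemma twisted_map_scattered:
  assumes "x \<noteq> 0" and eq: "twisted_map x * y = twisted_map y * x"
  shows "\<exists>k. \<sigma> k = k \<and> y = k * x"
proof -
  define h1 h2 h3 h4 h5 where hs: "h1 = \<sigma> h" "h2 = \<sigma> h1" "h3 = \<sigma> h2" "h4 = \<sigma> h3" "h5 = \<sigma> h4"
  have r: "h * h3 = - 1" "h1 * h4 = - 1" "h2 * h5 = - 1"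
    using h_norm h_norm_1 h_norm_2 by (simp_all add: hs)
  have nz: "h \<noteq> 0" "h1 \<noteq> 0" "h2 \<noteq> 0" "h3 \<noteq> 0" "h4 \<noteq> 0" "h5 \<noteq> 0"
    using r by auto
  have sh: "\<sigma> h = h1" "\<sigma> h1 = h2" "\<sigma> h2 = h3" "\<sigma> h3 = h4" "\<sigma> h4 = h5" "\<sigma> h5 = h"
    by (simp_all add: hs sigma_period)
  have "\<sigma> (h + \<sigma> h) \<noteq> 0"
    using conjugate_sum_neq_0 by (simp_all only: sigma_eq_0_iff not_False_eq_True)
  then have S1: "h1 + h2 \<noteq> 0"
    by (simp add: hs sigma_add)
  obtain X Y where XY: "h * x = X + Y" and X3: "\<sigma> (\<sigma> (\<sigma> X)) = h2 * h3 * X"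
    and Y3: "\<sigma> (\<sigma> (\<sigma> Y)) = - (h1 * h3 * Y)"
    using eigen_decomposition[of "h * x"] unfolding hs by metis
  obtain Z W where ZW: "h * y = Z + W" and Z3: "\<sigma> (\<sigma> (\<sigma> Z)) = h2 * h3 * Z"
    and W3: "\<sigma> (\<sigma> (\<sigma> W)) = - (h1 * h3 * W)"
    using eigen_decomposition[of "h * y"] unfolding hs by metis
  define X1 X2 Y1 Y2 Z1 Z2 W1 W2 where XYs: "X1 = \<sigma> X" "X2 = \<sigma> X1" "Y1 = \<sigma> Y" "Y2 = \<sigma> Y1"
    "Z1 = \<sigma> Z" "Z2 = \<sigma> Z1" "W1 = \<sigma> W" "W2 = \<sigma> W1"
  have sX: "\<sigma> X = X1" "\<sigma> X1 = X2" "\<sigma> X2 = h2 * h3 * X"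
    and sY: "\<sigma> Y = Y1" "\<sigma> Y1 = Y2" "\<sigma> Y2 = - (h1 * h3 * Y)"
    and sZ: "\<sigma> Z = Z1" "\<sigma> Z1 = Z2" "\<sigma> Z2 = h2 * h3 * Z"
    and sW: "\<sigma> W = W1" "\<sigma> W1 = W2" "\<sigma> W2 = - (h1 * h3 * W)"
    using X3 Y3 Z3 W3 by (simp_all add: XYs)
  note s = sh sX sY sZ sW sigma_add sigma_mult sigma_minus sigma_diff
  define B0 B1 where B: "B0 = h2 + h3" "B1 = h3 + h4"
  have "\<sigma> (h1 + h2) \<noteq> 0" "\<sigma> (\<sigma> (h1 + h2)) \<noteq> 0" "\<sigma> (\<sigma> (\<sigma> (h1 + h2))) \<noteq> 0"
    using S1 by (simp_all only: sigma_eq_0_iff not_False_eq_True)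
  then have B_nz: "B0 \<noteq> 0" "B1 \<noteq> 0" "h4 + h5 \<noteq> 0"
    by (simp_all add: B s)
  have fx: "twisted_map x = B1 * X2 - B0 * Y1"
    using twisted_map_decomposed[OF XY] X3 Y3 by (simp add: s B)
  have fy: "twisted_map y = B1 * Z2 - B0 * W1"
    using twisted_map_decomposed[OF ZW] Z3 W3 by (simp add: s B)
  \<comment> \<open>The terms of the cross-multiplied equation, grouped by the factor by which \<open>\<sigma>\<^sup>3\<close> scales them:
    \<open>G\<close> is fixed, \<open>B1 * N\<close> gets the factor \<open>h1 * h5\<close>, and \<open>B0 * M\<close> its inverse \<open>h2 * h4\<close>.\<close>
  define M where "M = Y1 * Z - W1 * X"
  define N where "N = X2 * W - Z2 * Y"
  define V where "V = Y1 * W - W1 * Y"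
  define U where "U = X2 * Z - Z2 * X"
  define G where "G = B1 * U - B0 * V"
  have "(B1 * X2 - B0 * Y1) * (Z + W) = (B1 * Z2 - B0 * W1) * (X + Y)"
    using eq unfolding fx fy by (simp flip: XY ZW)
  then have E1: "G + B1 * N - B0 * M = 0"
    unfolding G_def U_def V_def M_def N_def by algebra
  have sB: "\<sigma> B0 = B1" "\<sigma> B1 = h4 + h5"
    by (simp_all add: B s)
  have "h + h5 = - (h * h5 * B0)" "h1 + h = - (h * h1 * B1)"
    unfolding B using r by algebra+
  then have B3: "\<sigma> (\<sigma> (\<sigma> B0)) = - (h * h5 * B0)" "\<sigma> (\<sigma> (\<sigma> B1)) = - (h * h1 * B1)"
    by (simp_all add: B s add.commute)
  have M2: "\<sigma> (\<sigma> M) = h1 * h3 * N"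
    unfolding M_def N_def by (simp add: s algebra_simps)
  have M3: "\<sigma> (\<sigma> (\<sigma> M)) = - (h2\<^sup>2 * h3 * h4 * M)"
    unfolding M_def by (simp add: s) algebra
  have N3: "\<sigma> (\<sigma> (\<sigma> N)) = - (h1 * h3 * h4 * h5 * N)"
    unfolding N_def by (simp add: s) algebra
  have U3: "\<sigma> (\<sigma> (\<sigma> U)) = h2 * h3 * h4 * h5 * U"
    unfolding U_def by (simp add: s) algebra
  have V3: "\<sigma> (\<sigma> (\<sigma> V)) = h1 * h2 * h3 * h4 * V"
    unfolding V_def by (simp add: s) algebra
  have G3: "\<sigma> (\<sigma> (\<sigma> G)) = G"
  proof -
    have "\<sigma> (\<sigma> (\<sigma> G)) = - (h * h1 * B1) * (h2 * h3 * h4 * h5 * U) + h * h5 * B0 * (h1 * h2 * h3 * h4 * V)"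
      by (simp add: G_def sigma_diff sigma_mult B3 U3 V3)
    also have "\<dots> = G"
      unfolding G_def using r by algebra
    finally show ?thesis .
  qed
  have E2: "G + h1 * h5 * (B1 * N) - h2 * h4 * (B0 * M) = 0"
  proof -
    have "\<sigma> (\<sigma> (\<sigma> (G + B1 * N - B0 * M))) = 0"
      using E1 by (simp add: sigma_0)
    then have "G + h * h1 * B1 * (h1 * h3 * h4 * h5 * N) - h * h5 * B0 * (h2\<^sup>2 * h3 * h4 * M) = 0"
      by (simp add: sigma_diff sigma_add sigma_mult B3 G3 M3 N3)
    then show ?thesis
      using r by algebra
  qed
  \<comment> \<open>Subtracting the two equations eliminates \<open>G\<close> and leaves one relation between \<open>M\<close> and \<open>N\<close>;
    as \<open>N\<close> is a multiple of \<open>\<sigma>\<^sup>2 M\<close>, it relates \<open>M\<close> to its own conjugate.\<close>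
  have "h1 * h5 \<noteq> 1"
  proof
    assume "h1 * h5 = 1"
    then have "h1 + h2 = 0"
      using r(3) by algebra
    with S1 show False ..
  qed
  moreover have "(h1 * h5 - 1) * (B1 * N + h2 * h4 * (B0 * M)) = 0"
    using E1 E2 r by algebra
  ultimately have Q: "B1 * N = - (h2 * h4 * (B0 * M))"
    by (simp add: add_eq_0_iff)
  have R: "B1 * \<sigma> (\<sigma> M) = h2 * h3 * B0 * M"
    unfolding M2 using Q r(2) by algebra
  \<comment> \<open>The product of the relation \<open>R\<close> with its two conjugates would give \<open>1 = - 1\<close>.\<close>
  have "M = 0"
  proof (rule ccontr)
    assume "M \<noteq> 0"
    define M1 M2 where M12: "M1 = \<sigma> M" "M2 = \<sigma> M1"
    have M1: "M1 \<noteq> 0"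
      using \<open>M \<noteq> 0\<close> by (simp add: M12 sigma_eq_0_iff)
    have sM: "\<sigma> M = M1" "\<sigma> M1 = M2" "\<sigma> M2 = - (h2\<^sup>2 * h3 * h4 * M)"
      using M3 by (simp_all add: M12)
    have R0: "B1 * M2 = h2 * h3 * B0 * M"
      using R by (simp add: M12)
    have R1: "- ((h4 + h5) * (h2\<^sup>2 * h3 * h4 * M)) = h3 * h4 * B1 * M1"
      using arg_cong[OF R0, of \<sigma>] by (simp add: sM sB sigma_mult sigma_minus sh)
    have R2: "h * h5 * B0 * (h3\<^sup>2 * h4 * h5 * M1) = h4 * h5 * (h4 + h5) * M2"
      using arg_cong[OF R0, of "\<lambda>x. \<sigma> (\<sigma> x)"] B3(1)
      by (simp add: sM sB sigma_mult sigma_minus sh power2_eq_square)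
    have "h3 * h4 * h2 * M * B1 * ((h4 + h5) * h2 * M2 + h3 * B0 * M1) = 0"
      using R0 R1 by algebra
    then have "(h4 + h5) * h2 * M2 = - (h3 * B0 * M1)"
      using nz B_nz \<open>M \<noteq> 0\<close> by (simp add: add_eq_0_iff)
    moreover have "h4 * h5 * ((h4 + h5) * h2 * M2 - h3 * B0 * M1) = 0"
      using R2 r by algebra
    then have "(h4 + h5) * h2 * M2 = h3 * B0 * M1"
      using nz by simp
    ultimately have "2 * (h3 * B0 * M1) = 0"
      by algebra
    then show False
      using nz B_nz M1 two_neq_0 by simp
  qed
  moreover from this have "N = 0"
    using M2 nz by (simp add: sigma_0)
  ultimately have "G = 0"
    using E1 by simp
  \<comment> \<open>With \<open>M = 0\<close> and \<open>G = 0\<close> available, it remains to compare \<open>(X, Y)\<close> with \<open>(Z, W)\<close>.\<close>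
  have "\<exists>k. \<sigma> k = k \<and> Z + W = k * (X + Y)"
  proof (cases "Y = 0")
    case True
    with XY \<open>x \<noteq> 0\<close> nz have "X \<noteq> 0" by auto
    have "W1 = 0"
      using \<open>M = 0\<close> True \<open>X \<noteq> 0\<close> XYs by (simp add: M_def sigma_0)
    then have "W = 0"
      using XYs sigma_eq_0_iff by simp
    have "U = 0"
      using \<open>G = 0\<close> True \<open>W = 0\<close> B_nz by (simp add: G_def V_def)
    define k where "k = Z / X"
    have Zk: "Z = k * X"
      using \<open>X \<noteq> 0\<close> by (simp add: k_def)
    have X2: "X2 \<noteq> 0"
      using \<open>X \<noteq> 0\<close> by (simp add: XYs sigma_eq_0_iff)
    have "\<sigma> (\<sigma> k) = Z2 / X2"
      by (simp add: k_def s sigma_divide)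
    also have "\<dots> = k"
      using \<open>U = 0\<close> \<open>X \<noteq> 0\<close> X2 by (simp add: U_def k_def field_simps)
    finally have k2: "\<sigma> (\<sigma> k) = k" .
    have "\<sigma> (\<sigma> (\<sigma> k)) = k"
      using nz by (simp add: k_def s sigma_divide)
    \<comment> \<open>\<open>k\<close> is fixed by \<open>\<sigma>\<^sup>2\<close> and, as a ratio on one eigenline, by \<open>\<sigma>\<^sup>3\<close>, hence by \<open>\<sigma>\<close>.\<close>
    with k2 have "\<sigma> k = k"
      by simp
    then show ?thesis
      using Zk True \<open>W = 0\<close> by auto
  next
    case False
    then have Y1: "Y1 \<noteq> 0"
      by (simp add: XYs sigma_eq_0_iff)
    define m where "m = X / Y1"
    have Xm: "X = m * Y1"
      using Y1 by (simp add: m_def)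
    have Zm: "Z = m * W1"
      using \<open>M = 0\<close> Y1 unfolding M_def Xm by (simp add: algebra_simps)
    have "V = 0"
    proof (rule ccontr)
      assume "V \<noteq> 0"
      define m1 m2 where m: "m1 = \<sigma> m" "m2 = \<sigma> m1"
      have m3: "\<sigma> m2 = h1 * h3 * m"
      proof -
        have "h2 * h3 * X = - (\<sigma> m2 * (h2 * h4 * Y1))"
          using arg_cong[OF Xm, of "\<lambda>x. \<sigma> (\<sigma> (\<sigma> x))"] by (simp add: s m)
        then have "(\<sigma> m2 - h1 * h3 * m) * (h2 * h4 * Y1) = 0"
          unfolding Xm using r(2) by algebra
        then show ?thesis
          using nz Y1 by simp
      qed
      have "X2 = - (m2 * h1 * h3 * Y)" "Z2 = - (m2 * h1 * h3 * W)"
        using arg_cong[OF Xm, of "\<lambda>x. \<sigma> (\<sigma> x)"] arg_cong[OF Zm, of "\<lambda>x. \<sigma> (\<sigma> x)"]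
        by (simp_all add: s m algebra_simps)
      then have "U = h1 * h3 * m * m2 * V"
        unfolding U_def V_def Xm Zm by algebra
      then have "(B1 * h1 * h3 * m * m2 - B0) * V = 0"
        using \<open>G = 0\<close> unfolding G_def by algebra
      with \<open>V \<noteq> 0\<close> have L0: "B0 = B1 * h1 * h3 * m * m2"
        by simp
      \<comment> \<open>The product of \<open>L0\<close> with its conjugates determines \<open>h3 * g\<close> up to sign and thus makes it
        a fixed point of \<open>\<sigma>\<close>; the action of \<open>\<sigma>\<^sup>3\<close> on \<open>m\<close> makes it an eigenvector of \<open>\<sigma>\<close> for \<open>- 1\<close>.\<close>
      define g where "g = m * m1 * m2"
      have "(h3 * g)\<^sup>2 = 1"
      proof -
        have sm: "\<sigma> m = m1" "\<sigma> m1 = m2" "\<sigma> m2 = h1 * h3 * m"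
          using m3 by (simp_all add: m)
        have L1: "B1 = (h4 + h5) * h2 * h4 * m1 * (h1 * h3 * m)"
          using arg_cong[OF L0, of \<sigma>] by (simp add: sm sB sigma_mult sh)
        have L2: "h4 + h5 = - (h * h5 * B0) * h3 * h5 * m2 * (h2 * h4 * m1)"
          using arg_cong[OF L0, of "\<lambda>x. \<sigma> (\<sigma> x)"] B3(1) by (simp add: sm sB sigma_mult sh)
        have "B0 = - (h * h5 * B0) * h3 * h5 * m2 * (h2 * h4 * m1) * h2 * h4 * m1 * (h1 * h3 * m)
            * h1 * h3 * m * m2"
          using L0 unfolding L1 unfolding L2 .
        then have "B0 * ((h3 * g)\<^sup>2 - 1) = 0"
          unfolding g_def using r by algebra
        then show ?thesis
          using B_nz by simp
      qed
      then have "h3 * g = 1 \<or> h3 * g = - 1"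
        by (simp add: power2_eq_1_iff)
      then have "\<sigma> (h3 * g) = h3 * g"
        by (auto simp: sigma_1 sigma_minus)
      moreover have "\<sigma> (h3 * g) = h1 * h4 * (h3 * g)"
        by (simp add: g_def s m3 flip: m)
      ultimately have "2 * (h3 * g) = 0"
        using r(2) by algebra
      then show False
        using \<open>(h3 * g)\<^sup>2 = 1\<close> two_neq_0 by auto
    qed
    define k where "k = W / Y"
    have "\<sigma> k = k"
      unfolding k_def using False \<open>V = 0\<close> by (intro fixed_ratio) (simp_all add: V_def XYs)
    moreover have W: "W = k * Y"
      using False by (simp add: k_def)
    moreover have "W1 = k * Y1"
      using arg_cong[OF W, of \<sigma>] \<open>\<sigma> k = k\<close> by (simp add: s)
    ultimately show ?thesis
      unfolding Xm Zm by (intro exI[of _ k]) (simp add: algebra_simps)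
  qed
  then obtain k where k: "\<sigma> k = k" and "h * y = k * (h * x)"
    unfolding XY ZW by blast
  then have "h * (y - k * x) = 0"
    by (simp add: algebra_simps)
  with nz k show ?thesis
    by auto
qed

end

section \<open>Counting the points of the linear set\<close>

text \<open>As in Fermat's little theorem, multiplication by a nonzero \<open>x \<in> K\<close> permutes the nonzero elements
  of \<open>K\<close>, which gives one inclusion; the other holds because the polynomial \<open>X ^ q - X\<close> has at most
  \<open>q\<close> roots.\<close>

lemma subfield_eq_frobenius_fixed:
  fixes K :: "'a::finite_field set"
  assumes K: "is_subfield K" and card: "card K = q" and q: "q > 1"
  shows "K = {x. x ^ q = x}"
proof (rule card_seteq)
  show "finite {x :: 'a. x ^ q = x}"
    by simp
  show "K \<subseteq> {x. x ^ q = x}"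
  proof
    fix x assume x: "x \<in> K"
    have "x ^ q = x"
    proof (cases "x = 0")
      case False
      have "(\<Prod>y\<in>K - {0}. x * y) = (\<Prod>y\<in>K - {0}. y)"
        by (rule prod.reindex_bij_witness[of _ "\<lambda>y. inverse x * y" "\<lambda>y. x * y"])
          (use K x False in \<open>auto simp: is_subfield_def\<close>)
      moreover have "(\<Prod>y\<in>K - {0}. x * y) = x ^ (q - 1) * (\<Prod>y\<in>K - {0}. y)"
        using K card by (simp add: prod.distrib is_subfield_def)
      ultimately have "x ^ (q - 1) = 1"
        by simp
      then show ?thesis
        using q by (simp add: power_eq_if)
    qed (use q in simp)
    then show "x \<in> {x. x ^ q = x}" ..
  qed
  define P :: "'a poly" where "P = monom 1 q - monom 1 1"
  have "coeff P q = 1"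
    using q by (simp add: P_def)
  then have "P \<noteq> 0"
    by auto
  have "degree P \<le> q"
    unfolding P_def using q by (intro degree_diff_le) (auto simp: degree_monom_eq)
  have "{x. x ^ q = x} = {x. poly P x = 0}"
    by (simp add: P_def poly_monom)
  with card_poly_roots_bound[OF \<open>P \<noteq> 0\<close>] \<open>degree P \<le> q\<close> card
  show "card {x :: 'a. x ^ q = x} \<le> card K"
    by simp
qed

lemma line_span_graph_eq_iff:
  assumes "x \<noteq> 0" and "y \<noteq> 0"
  shows "line_span (x, a) = line_span (y, b) \<longleftrightarrow> a * y = b * x"
proof
  assume "line_span (x, a) = line_span (y, b)"
  moreover have "(x, a) \<in> line_span (x, a)"
    unfolding line_span_def by (force intro: exI[of _ 1])
  ultimately obtain c where "x = c * y" "a = c * b"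
    by (auto simp: line_span_def)
  then show "a * y = b * x"
    by simp
next
  assume "a * y = b * x"
  then have a: "a = x / y * b" and b: "b = y / x * a"
    using assms by (simp_all add: field_simps)
  have "(c * x, c * a) \<in> line_span (y, b)" for c
    unfolding line_span_def using assms a by (auto intro!: exI[of _ "c * x / y"])
  moreover have "(c * y, c * b) \<in> line_span (x, a)" for c
    unfolding line_span_def using assms b by (auto intro!: exI[of _ "c * y / x"])
  ultimately show "line_span (x, a) = line_span (y, b)"
    by (auto simp: line_span_def[of "(x, a)"] line_span_def[of "(y, b)"])
qed

text \<open>Under the hypotheses, the points that span the same line as \<open>(x, f x)\<close> are exactly those over the
  \<open>q - 1\<close> nonzero multiples of \<open>x\<close> by elements of \<open>K\<close>. The \<open>q ^ n - 1\<close> nonzero elements of the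
  field are therefore partitioned evenly among the lines.\<close>

lemma scatteredI:
  fixes f :: "'a::finite_field poly"
  assumes card_K: "card K = q" and "0 \<in> K" and q: "q > 1" and card_UNIV: "CARD('a) = q ^ n"
    and homogeneous: "\<And>k x. k \<in> K \<Longrightarrow> poly f (k * x) = k * poly f x"
    and ratio: "\<And>x y. x \<noteq> 0 \<Longrightarrow> poly f x * y = poly f y * x \<Longrightarrow> \<exists>k\<in>K. y = k * x"
  shows "scattered q n f"
proof -
  define S :: "'a set" where "S = UNIV - {0}"
  define g where "g x = line_span (x, poly f x)" for x
  have "poly f 0 = 0"
    using homogeneous[OF \<open>0 \<in> K\<close>, of 0] by simp
  then have "graph_space f - {(0, 0)} = (\<lambda>x. (x, poly f x)) ` S"
    by (auto simp: graph_space_def S_def)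
  then have L: "linear_set f = g ` S"
    by (simp add: linear_set_def g_def image_image)
  have fibre: "card {y \<in> S. g y = g x} = q - 1" if "x \<in> S" for x
  proof -
    have x: "x \<noteq> 0"
      using that by (simp add: S_def)
    have "{y \<in> S. g y = g x} = (\<lambda>k. k * x) ` (K - {0})"
    proof (intro subset_antisym subsetI)
      fix y assume "y \<in> {y \<in> S. g y = g x}"
      then have "y \<noteq> 0" "poly f x * y = poly f y * x"
        using x by (auto simp: S_def g_def line_span_graph_eq_iff)
      with ratio[OF x] show "y \<in> (\<lambda>k. k * x) ` (K - {0})"
        by fastforce
    next
      fix y assume "y \<in> (\<lambda>k. k * x) ` (K - {0})"
      then obtain k where "k \<in> K" "k \<noteq> 0" "y = k * x"
        by auto
      then show "y \<in> {y \<in> S. g y = g x}"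
        using x by (simp add: S_def g_def line_span_graph_eq_iff homogeneous)
    qed
    moreover have "inj_on (\<lambda>k. k * x) (K - {0})"
      using x by (simp add: inj_on_def)
    ultimately show ?thesis
      using card_K \<open>0 \<in> K\<close> by (simp add: card_image)
  qed
  have "q ^ n - 1 = (\<Sum>x\<in>S. 1)"
    by (simp add: S_def card_UNIV)
  also have "\<dots> = (\<Sum>l\<in>g ` S. \<Sum>y\<in>{y \<in> S. g y = l}. 1)"
    by (rule sum.image_gen) simp
  also have "\<dots> = (\<Sum>l\<in>g ` S. q - 1)"
    using fibre by (intro sum.cong) auto
  finally have "q ^ n - 1 = card (linear_set f) * (q - 1)"
    by (simp add: L)
  then show ?thesis
    using q by (simp add: scattered_def)
qed

text \<open>Translation by \<open>1\<close> permutes the field, so summing over all elements shows that the cardinality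
  vanishes in the field.\<close>

lemma CHAR_eq_of_CARD_prime_power:
  assumes "prime p" and "CARD('a::finite_field) = p ^ m"
  shows "CHAR('a) = p"
proof -
  have "(\<Sum>y::'a\<in>UNIV. y + 1) = (\<Sum>y\<in>UNIV. y)"
    by (rule sum.reindex_bij_witness[of _ "\<lambda>y. y - 1" "\<lambda>y. y + 1"]) auto
  then have "of_nat CARD('a) = (0 :: 'a)"
    by (simp add: sum.distrib)
  then have "CHAR('a) dvd p ^ m"
    using assms(2) by (metis of_nat_eq_0_iff_char_dvd)
  then have "CHAR('a) dvd p"
    using prime_CHAR_semidom[where 'a = 'a] CHAR_pos[where 'a = 'a] prime_dvd_power by blast
  then show ?thesis
    using assms(1) prime_CHAR_semidom[where 'a = 'a] CHAR_pos[where 'a = 'a]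
    by (metis primes_dvd_imp_eq)
qed

section \<open>The scattered polynomial\<close>

theorem theorem2p7:
  fixes p s q :: nat and F\<^sub>q :: "'a::finite_field set" and h :: 'a
  assumes "prime p" and "p > 2" and "s > 0" and "q = p ^ s"
    and "CARD('a) = q ^ 6"
    and "is_subfield F\<^sub>q" and "card F\<^sub>q = q"
    and "h ^ (q ^ 3 + 1) = - 1" and "h \<notin> F\<^sub>q"
  shows "q_polynomial q 6 (f_poly q h) \<and> scattered q 6 (f_poly q h)"
proof
  have q: "q > 1"
    using assms(2-4) one_less_power[of p s] by simp
  have char: "CHAR('a) = p"
    using assms(1,4,5) by (intro CHAR_eq_of_CARD_prime_power[of p "s * 6"]) (simp_all add: power_mult)
  have iterate: "((x ^ q) ^ q) = x ^ q\<^sup>2" "(((x ^ q) ^ q) ^ q) = x ^ q ^ 3"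
    "((((x ^ q) ^ q) ^ q) ^ q) = x ^ q ^ 4" "(((((x ^ q) ^ q) ^ q) ^ q) ^ q) = x ^ q ^ 5"
    "((((((x ^ q) ^ q) ^ q) ^ q) ^ q) ^ q) = x ^ q ^ 6" for x :: 'a
    by (simp_all add: eval_nat_numeral mult.assoc flip: power_mult)
  interpret order_six_twist "\<lambda>x. x ^ q" h
  proof
    show "(x + y) ^ q = x ^ q + y ^ q" for x y :: 'a
      using assms(1,4) char by (intro freshmans_dream') simp_all
    show "(((((((x :: 'a) ^ q) ^ q) ^ q) ^ q) ^ q) ^ q) = x" for x
      using finite_field_power_card_eq_same[of x] by (simp only: iterate(5) assms(5))
    show "(2 :: 'a) \<noteq> 0"
      using of_nat_eq_0_iff_char_dvd[of 2, where 'a = 'a] assms(2) char by (auto dest: dvd_imp_le)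
    show "h * ((h ^ q) ^ q) ^ q = - 1"
      using assms(8) by (simp add: iterate(2))
  qed (simp add: power_mult_distrib)
  have q2: "q\<^sup>2 \<ge> 1"
    using q by simp
  have "h ^ (q - 1) = h ^ q / h" "h ^ (q\<^sup>2 - 1) = h ^ q\<^sup>2 / h"
    using h_neq_0 q q2 by (simp_all add: power_diff)
  then have poly: "poly (f_poly q h) x = twisted_map x" for x
    by (simp add: f_poly_def twisted_map_def poly_monom flip: iterate)
  show "q_polynomial q 6 (f_poly q h)"
    unfolding q_polynomial_def f_poly_def
    by (rule exI[of _ "\<lambda>i. [0, h ^ (q - 1), - (h ^ (q\<^sup>2 - 1)), 0, 1, 1] ! i"])
      (simp add: eval_nat_numeral minus_monom)
  have Fq: "F\<^sub>q = {k. k ^ q = k}"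
    using assms(6,7) q by (rule subfield_eq_frobenius_fixed)
  show "scattered q 6 (f_poly q h)"
  proof (rule scatteredI)
    show "card F\<^sub>q = q" "0 \<in> F\<^sub>q" "q > 1" "CARD('a) = q ^ 6"
      using assms q by (simp_all add: Fq)
    show "poly (f_poly q h) (k * x) = k * poly (f_poly q h) x" if "k \<in> F\<^sub>q" for k x
      using that unfolding poly by (simp add: Fq twisted_map_def power_mult_distrib algebra_simps)
    show "\<exists>k\<in>F\<^sub>q. y = k * x"
      if "x \<noteq> 0" "poly (f_poly q h) x * y = poly (f_poly q h) y * x" for x y
      using twisted_map_scattered[of x y] that unfolding poly Fq by auto
  qed
qed

end
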